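(* Let $P$ be an mca-program over a set of atoms $\mathit{At}$ and let $M \subseteq \mathit{At}$. Then $M$ is a model of $P$ if and only if there exists $M' \in T^{\mathit{nd}}_P(M)$ such that $M' \subseteq M$.
   Context: Let $\mathit{At}$ be a set of propositional atoms. An mc-atom over $\mathit{At}$ is an expression $kX$, where $k$ is a non-negative integer and $X \subseteq \mathit{At}$ is finite with $k \leq |X|$; its atom set is $\mathit{aset}(kX) = X$. An mc-literal is an expression $A$ or $\mathbf{not}(A)$, where $A$ is an mc-atom. An mca-clause $r$ is an expression $H \leftarrow L_1, \ldots, L_m$ ($m \geq 0$), where $H$ is an mc-atom and the $L_i$ are mc-literals. It has head $\mathit{hd}(r) = H$, body $\mathit{bd}(r) = \{L_1, \ldots, L_m\}$, and head set $\mathit{hset}(r) = \mathit{aset}(H)$. An mca-program is a set of mca-clauses. For a set $Q$ of clauses, $\mathit{hset}(Q) = \bigcup\{\mathit{hset}(r) : r \in Q\}$. Satisfaction, for $M \subseteq \mathit{At}$: - $M \models kX$ iff $|M \cap X| \geq k$. - $M \models \mathbf{not}(kX)$ iff $|M \cap X| < k$. - $M \models \mathit{bd}(r)$ iff $M$ satisfies all literals in $\mathit{bd}(r)$. - $M$ satisfies a clause $r$ if $M \models \mathit{hd}(r)$ whenever $M \models \mathit{bd}(r)$. - $M$ is a model of $P$ if it satisfies every clause of $P$. Operators: - $P(M) = \{r \in P : M \models \mathit{bd}(r)\}$. - $T^{\mathit{nd}}_P(M)$ is the set of all $M'$ with $M' \subseteq \mathit{hset}(P(M))$ and $M' \models \mathit{hd}(r)$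 for all $r \in P(M)$. *)

theory Defs
  imports Main
begin

(* The side conditions on an mc-atom kX over At (X a finite subset of At, k at most the
   cardinality of X) are not part of the datatypes; they are imposed by mc_atom_over and the
   predicates built on it. *)

datatype 'a mc_atom = MCAtom nat (aset: "'a set")

datatype 'a mc_literal = PosLit "'a mc_atom" | NotLit "'a mc_atom"

datatype 'a mca_clause = Clause (head: "'a mc_atom") (body_list: "'a mc_literal list")

definition body :: "'a mca_clause \<Rightarrow> 'a mc_literal set" where
  "body r = set (body_list r)"

definition hset :: "'a mca_clause \<Rightarrow> 'a set" where
  "hset r = aset (head r)"

definition hset_prog :: "'a mca_clause set \<Rightarrow> 'a set" where
  "hset_prog Q = (\<Union>r\<in>Q. hset r)"

fun mc_atom_over :: "'a set \<Rightarrow> 'a mc_atom \<Rightarrow> bool" where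
  "mc_atom_over At (MCAtom k X) \<longleftrightarrow> X \<subseteq> At \<and> finite X \<and> k \<le> card X"

fun mc_literal_over :: "'a set \<Rightarrow> 'a mc_literal \<Rightarrow> bool" where
  "mc_literal_over At (PosLit A) \<longleftrightarrow> mc_atom_over At A"
| "mc_literal_over At (NotLit A) \<longleftrightarrow> mc_atom_over At A"

definition mca_clause_over :: "'a set \<Rightarrow> 'a mca_clause \<Rightarrow> bool" where
  "mca_clause_over At r \<longleftrightarrow> mc_atom_over At (head r) \<and> (\<forall>L\<in>body r. mc_literal_over At L)"

definition mca_program_over :: "'a set \<Rightarrow> 'a mca_clause set \<Rightarrow> bool" where
  "mca_program_over At P \<longleftrightarrow> (\<forall>r\<in>P. mca_clause_over At r)"

fun sat_atom :: "'a set \<Rightarrow> 'a mc_atom \<Rightarrow> bool" where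
  "sat_atom M (MCAtom k X) \<longleftrightarrow> card (M \<inter> X) \<ge> k"

fun sat_literal :: "'a set \<Rightarrow> 'a mc_literal \<Rightarrow> bool" where
  "sat_literal M (PosLit A) \<longleftrightarrow> sat_atom M A"
| "sat_literal M (NotLit (MCAtom k X)) \<longleftrightarrow> card (M \<inter> X) < k"

definition sat_body :: "'a set \<Rightarrow> 'a mca_clause \<Rightarrow> bool" where
  "sat_body M r \<longleftrightarrow> (\<forall>L\<in>body r. sat_literal M L)"

definition sat_clause :: "'a set \<Rightarrow> 'a mca_clause \<Rightarrow> bool" where
  "sat_clause M r \<longleftrightarrow> (sat_body M r \<longrightarrow> sat_atom M (head r))"

definition is_model :: "'a set \<Rightarrow> 'a mca_clause set \<Rightarrow> bool" where
  "is_model M P \<longleftrightarrow> (\<forall>r\<in>P. sat_clause M r)"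

definition applicable :: "'a mca_clause set \<Rightarrow> 'a set \<Rightarrow> 'a mca_clause set" where
  "applicable P M = {r \<in> P. sat_body M r}"

definition T_nd :: "'a mca_clause set \<Rightarrow> 'a set \<Rightarrow> 'a set set" where
  "T_nd P M = {M'. M' \<subseteq> hset_prog (applicable P M) \<and>
                   (\<forall>r\<in>applicable P M. sat_atom M' (head r))}"

end

theory Submission
  imports Defs
begin

text \<open>Satisfaction of kX by M depends only on M \<inter> X and persists when M grows. Being a
  model means satisfying the heads of the clauses applicable in M. So a model can be cut down to the
  atoms of these heads without changing its trace on any of them (\<open>sat_atom_cong\<close>),
  which gives the required member of \<open>T_nd P M\<close>. Conversely, heads satisfied by a
  subset of M stay satisfied by M (\<open>sat_atom_mono\<close>).\<close>

lemma sat_atom_cong: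
  assumes "M \<inter> aset A = M' \<inter> aset A"
  shows "sat_atom M A \<longleftrightarrow> sat_atom M' A"
  using assms by (cases A) simp

text \<open>Finiteness matters: \<open>card\<close> of an infinite set is 0, so enlarging
  \<open>M'\<close> could otherwise lower the count.\<close>

lemma sat_atom_mono:
  assumes "sat_atom M' A" and "M' \<subseteq> M" and "finite (aset A)"
  shows "sat_atom M A"
proof (cases A)
  case (MCAtom k X)
  with assms have "card (M' \<inter> X) \<le> card (M \<inter> X)"
    by (intro card_mono) auto
  with MCAtom assms(1) show ?thesis by simp
qed

lemma finite_aset_if_mc_atom_over: "mc_atom_over At A \<Longrightarrow> finite (aset A)"
  by (cases A) simp

lemma is_model_iff_applicable:
  "is_model M P \<longleftrightarrow> (\<forall>r\<in>applicable P M. sat_atom M (head r))"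
  by (auto simp: is_model_def sat_clause_def applicable_def)

theorem theorem1:
  fixes At :: "'a set" and P :: "'a mca_clause set" and M :: "'a set"
  assumes "mca_program_over At P" and "M \<subseteq> At"
  shows "is_model M P \<longleftrightarrow> (\<exists>M'\<in>T_nd P M. M' \<subseteq> M)"
proof
  assume model: "is_model M P"
  let ?M' = "M \<inter> hset_prog (applicable P M)"
  have "sat_atom ?M' (head r)" if r: "r \<in> applicable P M" for r
  proof -
    \<comment> \<open>The atoms of an applicable head all lie in
      \<open>hset_prog (applicable P M)\<close>, so the cut removes none of them.\<close>
    have "?M' \<inter> aset (head r) = M \<inter> aset (head r)"
      using r by (auto simp: hset_prog_def hset_def)
    then show ?thesis
      using model r sat_atom_cong by (metis is_model_iff_applicable)
  qed
  then have "?M' \<in> T_nd P M" by (simp add: T_nd_def)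
  then show "\<exists>M'\<in>T_nd P M. M' \<subseteq> M" by blast
next
  assume "\<exists>M'\<in>T_nd P M. M' \<subseteq> M"
  then obtain M' where "M' \<subseteq> M" and sat: "\<forall>r\<in>applicable P M. sat_atom M' (head r)"
    by (auto simp: T_nd_def)
  \<comment> \<open>Well-formedness over \<open>At\<close> yields the finiteness that
    \<open>sat_atom_mono\<close> asks for.\<close>
  moreover have "finite (aset (head r))" if "r \<in> applicable P M" for r
    using that assms(1) finite_aset_if_mc_atom_over
    by (auto simp: applicable_def mca_program_over_def mca_clause_over_def)
  ultimately show "is_model M P"
    unfolding is_model_iff_applicable using sat_atom_mono by blast
qed

end
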